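(* Let $M$ be a primitive substitution matrix on $n$ letters and let $m>n$ be another natural number. Then there exists a primitive substitution matrix $D$ on $m$ letters such that the Bratteli diagram defined by $M$ is telescope equivalent to the Bratteli diagram defined by $D$.
   Context: A symbolic substitution on a finite nonempty alphabet $\mathcal L=\{l_1,\dots,l_n\}$ is a map $\sigma:\mathcal L\to\mathcal L^*$ into the finite words over $\mathcal L$. Its substitution matrix is the $n\times n$ non-negative integer matrix whose $(i,j)$-entry is the number of occurrences of $l_j$ in $\sigma(l_i)$. A non-negative square matrix is primitive if some power $M^k$, $k\in\mathbb N$, has all entries strictly positive. A (labelled) Bratteli diagram $(V,E,r,s,d)$ is an infinite directed graph with $V=\bigsqcup_{n\ge 0}V_n$, $E=\bigsqcup_{n\ge1}E_n$, all $V_n,E_n$ finite and nonempty, with $s(e)\in V_{n-1}$ and $r(e)\in V_n$ for $e\in E_n$; $s^{-1}(v)\ne\varnothing$ for all $v$, $r^{-1}(v)\neq\varnothing$ for all $v\notin V_0$; and a labelling $d:V\to\mathbb N$ with $d(v)=\sum_{r(e)=v}d(s(e))$ for $v\notin V_0$. The transition matrix from level $n-1$ to level $n$ has $(i,j)$-entry equal to the number of edges from the $i$-th vertex of $V_{n-1}$ to the $j$-th vertex of $V_n$. Two diagrams are isomorphic if there are bijections between their vertices and edges (level by level) preserving labels, range and source. Given a strictly increasing sequence $(m_n)_{n\ge0}$ of non-negative integers, the telescoping of the diagram has $V_n'=V_{m_n}$, $E_n'$ the set of paths from $V_{m_{n-1}}$ to $V_{m_n}$, with the induced range and source and restricted labelling;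 microscoping is the inverse operation. Two diagrams are telescope equivalent if one is obtained from the other by finitely many telescopings, microscopings and isomorphisms. The Bratteli diagram defined by (associated to) an $n\times n$ substitution matrix $M$ has $n$ vertices at every level, all labels equal to $1$ at level $0$, and every transition matrix equal to $M$ (it is understood that $M$ has no zero row or column, so that this is a Bratteli diagram).
   Formalization: The 1×1 matrix M = (1) (substitution a ↦ a) is excluded: it is primitive, but its diagram has all labels 1, while every primitive D on m ≥ 2 letters has unbounded labels, and boundedness is invariant under telescope equivalence. *)

theory Defs
  imports "Jordan_Normal_Form.Matrix"
begin

section \<open>Substitutions\<close>

text \<open>The list \<open>ls\<close> enumerates the alphabet \<open>l\<^sub>1, \<dots>, l\<^sub>n\<close> without repetition; indices start at 0.\<close>

definition symbolic_substitution :: "'a list \<Rightarrow> ('a \<Rightarrow> 'a list) \<Rightarrow> bool" where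
  "symbolic_substitution ls \<sigma> \<longleftrightarrow>
     ls \<noteq> [] \<and> distinct ls \<and> (\<forall>l \<in> set ls. \<sigma> l \<in> lists (set ls))"

definition substitution_mat :: "'a list \<Rightarrow> ('a \<Rightarrow> 'a list) \<Rightarrow> nat mat" where
  "substitution_mat ls \<sigma> =
     mat (length ls) (length ls) (\<lambda>(i, j). count_list (\<sigma> (ls ! i)) (ls ! j))"

text \<open>Since the matrix depends on the letters only through their enumeration, taking natural
  numbers as letters is no restriction.\<close>

definition is_substitution_mat :: "nat \<Rightarrow> nat mat \<Rightarrow> bool" where
  "is_substitution_mat n M \<longleftrightarrow>
     (\<exists>(ls :: nat list) \<sigma>. symbolic_substitution ls \<sigma> \<and> length ls = n \<and> M = substitution_mat ls \<sigma>)"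

definition primitive_mat :: "nat mat \<Rightarrow> bool" where
  "primitive_mat M \<longleftrightarrow> square_mat M \<and>
     (\<exists>k \<ge> 1. \<forall>i < dim_row M. \<forall>j < dim_row M. 0 < (M ^\<^sub>m k) $$ (i, j))"


section \<open>Labelled Bratteli diagrams\<close>

record ('v, 'e) bratteli =
  verts :: "nat \<Rightarrow> 'v set"
  edges :: "nat \<Rightarrow> 'e set"
  rng :: "'e \<Rightarrow> 'v"
  src :: "'e \<Rightarrow> 'v"
  lab :: "'v \<Rightarrow> nat"

text \<open>Edge levels start at 1, so \<open>edges B 0\<close> is required to be empty.\<close>

definition bratteli_diagram :: "('v, 'e) bratteli \<Rightarrow> bool" where
  "bratteli_diagram B \<longleftrightarrow>
     disjoint_family (verts B) \<and> disjoint_family (edges B) \<and>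
     (\<forall>n. finite (verts B n) \<and> verts B n \<noteq> {}) \<and>
     edges B 0 = {} \<and> (\<forall>n \<ge> 1. finite (edges B n) \<and> edges B n \<noteq> {}) \<and>
     (\<forall>n \<ge> 1. \<forall>e \<in> edges B n. src B e \<in> verts B (n - 1) \<and> rng B e \<in> verts B n) \<and>
     (\<forall>n. \<forall>v \<in> verts B n. \<exists>e \<in> (\<Union>k. edges B k). src B e = v) \<and>
     (\<forall>n \<ge> 1. \<forall>v \<in> verts B n. \<exists>e \<in> (\<Union>k. edges B k). rng B e = v) \<and>
     (\<forall>n. \<forall>v \<in> verts B n. 0 < lab B v) \<and>
     (\<forall>n \<ge> 1. \<forall>v \<in> verts B n. lab B v = (\<Sum>e | e \<in> (\<Union>k. edges B k) \<and> rng B e = v. lab B (src B e)))"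

text \<open>Transition matrix from level \<open>n - 1\<close> to level \<open>n\<close>, for given enumerations \<open>us\<close> and \<open>vs\<close> of the
  vertices of these levels.\<close>

definition transition_mat :: "('v, 'e) bratteli \<Rightarrow> nat \<Rightarrow> 'v list \<Rightarrow> 'v list \<Rightarrow> nat mat" where
  "transition_mat B n us vs = mat (length us) (length vs)
     (\<lambda>(i, j). card {e \<in> edges B n. src B e = us ! i \<and> rng B e = vs ! j})"

definition bratteli_iso :: "('v, 'e) bratteli \<Rightarrow> ('w, 'f) bratteli \<Rightarrow> bool" where
  "bratteli_iso B C \<longleftrightarrow> (\<exists>f g.
     (\<forall>n. bij_betw f (verts B n) (verts C n)) \<and>
     (\<forall>n. bij_betw g (edges B n) (edges C n)) \<and>
     (\<forall>n. \<forall>v \<in> verts B n. lab C (f v) = lab B v) \<and>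
     (\<forall>n. \<forall>e \<in> edges B n. rng C (g e) = f (rng B e) \<and> src C (g e) = f (src B e)))"

definition paths :: "('v, 'e) bratteli \<Rightarrow> nat \<Rightarrow> nat \<Rightarrow> 'e list set" where
  "paths B k l = {es. length es = l - k \<and>
     (\<forall>i < l - k. es ! i \<in> edges B (k + i + 1)) \<and>
     (\<forall>i. i + 1 < l - k \<longrightarrow> rng B (es ! i) = src B (es ! (i + 1)))}"

definition telescoping :: "(nat \<Rightarrow> nat) \<Rightarrow> ('v, 'e) bratteli \<Rightarrow> ('v, 'e list) bratteli" where
  "telescoping m B = \<lparr>
     verts = (\<lambda>n. verts B (m n)),
     edges = (\<lambda>n. if n = 0 then {} else paths B (m (n - 1)) (m n)),
     rng = (\<lambda>es. rng B (last es)),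
     src = (\<lambda>es. src B (hd es)),
     lab = lab B\<rparr>"

text \<open>A single move: isomorphism, telescoping or microscoping. As telescoping changes the type of the
  edges, moves are composed with isomorphisms and take place between diagrams whose vertices and
  edges are natural numbers; every diagram, being countable, is isomorphic to one of these.\<close>

definition telescope_move :: "(nat, nat) bratteli \<Rightarrow> (nat, nat) bratteli \<Rightarrow> bool" where
  "telescope_move B C \<longleftrightarrow> bratteli_diagram B \<and> bratteli_diagram C \<and>
     (bratteli_iso B C \<or>
      (\<exists>m. strict_mono m \<and> bratteli_iso (telescoping m B) C) \<or>
      (\<exists>m. strict_mono m \<and> bratteli_iso (telescoping m C) B))"

definition telescope_equivalent :: "('v, 'e) bratteli \<Rightarrow> ('w, 'f) bratteli \<Rightarrow> bool" where
  "telescope_equivalent B C \<longleftrightarrow> bratteli_diagram B \<and> bratteli_diagram C \<and>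
     (\<exists>B' C'. bratteli_iso B B' \<and> telescope_move\<^sup>*\<^sup>* B' C' \<and> bratteli_iso C' C)"


section \<open>The diagram of a substitution matrix\<close>

text \<open>The vertex \<open>(k, i)\<close> is the \<open>i\<close>-th vertex of level \<open>k\<close>; the edge \<open>(k, i, j, c)\<close> is the \<open>c\<close>-th edge
  from \<open>(k - 1, i)\<close> to \<open>(k, j)\<close>.\<close>

primrec level_label :: "nat mat \<Rightarrow> nat \<Rightarrow> nat \<Rightarrow> nat" where
  "level_label M 0 j = 1"
| "level_label M (Suc k) j = (\<Sum>i < dim_row M. level_label M k i * M $$ (i, j))"

definition mat_diagram :: "nat mat \<Rightarrow> (nat \<times> nat, nat \<times> nat \<times> nat \<times> nat) bratteli" where
  "mat_diagram M = \<lparr>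
     verts = (\<lambda>k. {k} \<times> {..<dim_row M}),
     edges = (\<lambda>k. {(k', i, j, c). k' = k \<and> 1 \<le> k \<and> i < dim_row M \<and> j < dim_row M \<and> c < M $$ (i, j)}),
     rng = (\<lambda>(k, i, j, c). (k, j)),
     src = (\<lambda>(k, i, j, c). (k - 1, i)),
     lab = (\<lambda>(k, i). level_label M k i)\<rparr>"

lemma transition_mat_mat_diagram:
  assumes "square_mat M" "1 \<le> k"
  shows "transition_mat (mat_diagram M) k
           (map (Pair (k - 1)) [0..<dim_row M]) (map (Pair k) [0..<dim_row M]) = M"
proof (rule eq_matI)
  fix i j assume ij: "i < dim_row M" "j < dim_col M"
  have "{e \<in> edges (mat_diagram M) k. src (mat_diagram M) e = (k - 1, i) \<and> rng (mat_diagram M) e = (k, j)}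
        = (\<lambda>c. (k, i, j, c)) ` {..<M $$ (i, j)}"
    using ij assms by (auto simp: mat_diagram_def)
  then show "transition_mat (mat_diagram M) k
       (map (Pair (k - 1)) [0..<dim_row M]) (map (Pair k) [0..<dim_row M]) $$ (i, j) = M $$ (i, j)"
    using ij assms by (simp add: transition_mat_def card_image inj_on_def)
qed (use assms in \<open>simp_all add: transition_mat_def\<close>)

lemma level_label_pos:
  assumes "\<And>j. j < dim_row M \<Longrightarrow> \<exists>i < dim_row M. M $$ (i, j) \<noteq> 0" "j < dim_row M"
  shows "0 < level_label M k j"
  using assms(2)
proof (induction k arbitrary: j)
  case (Suc k)
  obtain i where "i < dim_row M" "M $$ (i, j) \<noteq> 0" using assms(1) Suc.prems by blast
  then show ?case using Suc.IH[of i] by (auto intro!: sum_pos2[of _ i])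
qed simp

lemma bratteli_diagram_mat_diagram:
  assumes "square_mat M" "0 < dim_row M"
    and rows: "\<And>i. i < dim_row M \<Longrightarrow> \<exists>j < dim_row M. M $$ (i, j) \<noteq> 0"
    and cols: "\<And>j. j < dim_row M \<Longrightarrow> \<exists>i < dim_row M. M $$ (i, j) \<noteq> 0"
  shows "bratteli_diagram (mat_diagram M)"
proof -
  let ?B = "mat_diagram M" and ?n = "dim_row M"
  have E: "edges ?B k = Pair k ` (SIGMA i:{..<?n}. SIGMA j:{..<?n}. {..<M $$ (i, j)})" if "1 \<le> k" for k
    using that by (auto simp: mat_diagram_def)
  have "finite (edges ?B k)" if "1 \<le> k" for k
    unfolding E[OF that] by (intro finite_imageI finite_SigmaI) auto
  moreover have "edges ?B k \<noteq> {}" if "1 \<le> k" for k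
    using rows[OF assms(2)] assms(2) unfolding E[OF that] by fastforce
  moreover have "\<exists>e \<in> (\<Union>k. edges ?B k). src ?B e = v" if v: "v \<in> verts ?B k" for k v
  proof -
    obtain i where i: "v = (k, i)" "i < ?n" using v by (auto simp: mat_diagram_def)
    then obtain j where "j < ?n" "0 < M $$ (i, j)" using rows by blast
    then have "(Suc k, i, j, 0) \<in> edges ?B (Suc k)" "src ?B (Suc k, i, j, 0) = v"
      using i by (auto simp: mat_diagram_def)
    then show ?thesis by blast
  qed
  moreover have "\<exists>e \<in> (\<Union>k. edges ?B k). rng ?B e = v" if v: "v \<in> verts ?B k" "1 \<le> k" for k v
  proof -
    obtain j where j: "v = (k, j)" "j < ?n" using v by (auto simp: mat_diagram_def)
    then obtain i where "i < ?n" "0 < M $$ (i, j)" using cols by blast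
    then have "(k, i, j, 0) \<in> edges ?B k" "rng ?B (k, i, j, 0) = v"
      using j v by (auto simp: mat_diagram_def)
    then show ?thesis by blast
  qed
  moreover have "lab ?B v = (\<Sum>e | e \<in> (\<Union>k. edges ?B k) \<and> rng ?B e = v. lab ?B (src ?B e))"
    if v: "v \<in> verts ?B k" "1 \<le> k" for k v
  proof -
    obtain j where j: "v = (k, j)" "j < ?n" using v by (auto simp: mat_diagram_def)
    obtain k' where k': "k = Suc k'" using v(2) by (cases k) auto
    have "{e. e \<in> (\<Union>k. edges ?B k) \<and> rng ?B e = v}
          = (\<lambda>(i, c). (k, i, j, c)) ` (SIGMA i:{..<?n}. {..<M $$ (i, j)})"
      using j v(2) by (auto simp: mat_diagram_def)
    then have "(\<Sum>e | e \<in> (\<Union>k. edges ?B k) \<and> rng ?B e = v. lab ?B (src ?B e))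
          = (\<Sum>(i, c) \<in> (SIGMA i:{..<?n}. {..<M $$ (i, j)}). level_label M k' i)"
      by (simp, subst sum.reindex) (auto simp: inj_on_def mat_diagram_def k' intro!: sum.cong)
    also have "\<dots> = (\<Sum>i < ?n. \<Sum>c < M $$ (i, j). level_label M k' i)"
      by (subst sum.Sigma) auto
    finally show ?thesis using j k' by (simp add: mat_diagram_def mult.commute)
  qed
  ultimately show ?thesis
    using assms(2) level_label_pos[OF cols] unfolding bratteli_diagram_def
    by (auto simp: mat_diagram_def disjoint_family_on_def)
qed


section \<open>The trivial substitution\<close>

text \<open>The matrix \<open>(1)\<close> of \<open>a \<mapsto> a\<close> is primitive, but its diagram is not telescope equivalent to that of
  any primitive matrix on at least two letters: boundedness of the labels is invariant under
  telescope equivalence.\<close>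

definition bounded_labels :: "('v, 'e) bratteli \<Rightarrow> bool" where
  "bounded_labels B \<longleftrightarrow> (\<exists>b. \<forall>n. \<forall>v \<in> verts B n. lab B v \<le> b)"

lemma bounded_labels_iso:
  assumes "bratteli_iso B C"
  shows "bounded_labels B \<longleftrightarrow> bounded_labels C"
proof -
  obtain f where f: "\<And>n. bij_betw f (verts B n) (verts C n)"
    and l: "\<And>n v. v \<in> verts B n \<Longrightarrow> lab C (f v) = lab B v"
    using assms unfolding bratteli_iso_def by blast
  have "lab C ` verts C n = lab B ` verts B n" for n
    using bij_betw_imp_surj_on[OF f[of n]] l by force
  then have "(\<forall>v \<in> verts B n. lab B v \<le> b) \<longleftrightarrow> (\<forall>v \<in> verts C n. lab C v \<le> b)" for n b
    by (metis (no_types, lifting) imageE imageI)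
  then show ?thesis unfolding bounded_labels_def by simp
qed

lemma bratteli_level_unique:
  "bratteli_diagram B \<Longrightarrow> v \<in> verts B k \<Longrightarrow> v \<in> verts B l \<Longrightarrow> k = l"
  unfolding bratteli_diagram_def disjoint_family_on_def by blast

lemma ascend:
  assumes B: "bratteli_diagram B" and "v \<in> verts B k"
  shows "\<exists>w \<in> verts B (k + t). lab B v \<le> lab B w"
proof (induction t)
  case (Suc t)
  then obtain w where w: "w \<in> verts B (k + t)" "lab B v \<le> lab B w" by blast
  then obtain e l where e: "e \<in> edges B l" "src B e = w"
    using B unfolding bratteli_diagram_def by blast
  have l: "1 \<le> l" using B e(1) unfolding bratteli_diagram_def
    by (metis One_nat_def Suc_leI empty_iff gr0I)
  then have se: "src B e \<in> verts B (l - 1)" "rng B e \<in> verts B l"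
    using B e(1) unfolding bratteli_diagram_def by blast+
  have "l - 1 = k + t"
    using bratteli_level_unique[OF B] se(1) w(1) e(2) by blast
  then have l': "l = k + Suc t" using l by simp
  let ?T = "{e'. e' \<in> (\<Union>k. edges B k) \<and> rng B e' = rng B e}"
  have "?T \<subseteq> edges B l"
  proof
    fix e' assume "e' \<in> ?T"
    then obtain l2 where l2: "e' \<in> edges B l2" "rng B e' = rng B e" by blast
    have "1 \<le> l2" using B l2(1) unfolding bratteli_diagram_def
      by (metis One_nat_def Suc_leI empty_iff gr0I)
    then have "rng B e' \<in> verts B l2" using B l2(1) unfolding bratteli_diagram_def by blast
    then have "l2 = l" using bratteli_level_unique[OF B] se(2) l2(2) by metis
    then show "e' \<in> edges B l" using l2(1) by simp
  qed
  moreover have "finite (edges B l)" using B l unfolding bratteli_diagram_def by blast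
  ultimately have "finite ?T" by (rule finite_subset)
  then have "lab B (src B e) \<le> (\<Sum>e' \<in> ?T. lab B (src B e'))"
    using e(1) by (intro member_le_sum) auto
  also have "\<dots> = lab B (rng B e)" using B l se(2) unfolding bratteli_diagram_def by simp
  finally show ?case using se(2) w(2) e(2) l' by (intro bexI[of _ "rng B e"]) auto
qed (use assms in auto)

lemma bounded_labels_telescoping:
  assumes "bratteli_diagram B" "strict_mono m"
  shows "bounded_labels (telescoping m B) \<longleftrightarrow> bounded_labels B"
proof
  assume "bounded_labels (telescoping m B)"
  then obtain b where b: "\<And>n v. v \<in> verts B (m n) \<Longrightarrow> lab B v \<le> b"
    unfolding bounded_labels_def telescoping_def by auto
  have "lab B v \<le> b" if v: "v \<in> verts B n" for n v
  proof -
    have "n \<le> m n" using assms(2) by (rule strict_mono_imp_increasing)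
    then obtain w where "w \<in> verts B (m n)" "lab B v \<le> lab B w"
      using ascend[OF assms(1) v, of "m n - n"] by auto
    then show ?thesis using b le_trans by blast
  qed
  then show "bounded_labels B" unfolding bounded_labels_def by blast
qed (auto simp: bounded_labels_def telescoping_def)

lemma bounded_labels_telescope_equivalent:
  assumes "telescope_equivalent B C"
  shows "bounded_labels B \<longleftrightarrow> bounded_labels C"
proof -
  have move: "bounded_labels X \<longleftrightarrow> bounded_labels Y" if "telescope_move X Y" for X Y
    using that bounded_labels_iso bounded_labels_telescoping unfolding telescope_move_def by metis
  have "bounded_labels X \<longleftrightarrow> bounded_labels Y" if "telescope_move\<^sup>*\<^sup>* X Y" for X Y
    using that by induction (use move in auto)
  then show ?thesis using assms bounded_labels_iso unfolding telescope_equivalent_def by metis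
qed

lemma level_label_add:
  assumes "M \<in> carrier_mat n n" "j < n"
  shows "level_label M (k + t) j = (\<Sum>i < n. level_label M k i * (M ^\<^sub>m t) $$ (i, j))"
  using assms(2)
proof (induction t arbitrary: j)
  case 0
  have "(\<Sum>i < n. level_label M k i * (M ^\<^sub>m 0) $$ (i, j)) = (\<Sum>i < n. if i = j then level_label M k i else 0)"
    using assms(1) 0 by (intro sum.cong) auto
  then show ?case using 0 by simp
next
  case (Suc t)
  have P: "M ^\<^sub>m t \<in> carrier_mat n n" using assms(1) by (rule pow_carrier_mat)
  have e: "(M ^\<^sub>m Suc t) $$ (i, j) = (\<Sum>l < n. (M ^\<^sub>m t) $$ (i, l) * M $$ (l, j))" if "i < n" for i
    using that P assms(1) Suc.prems by (simp add: scalar_prod_def atLeast0LessThan)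
  have "level_label M (k + Suc t) j
      = (\<Sum>l < n. \<Sum>i < n. level_label M k i * ((M ^\<^sub>m t) $$ (i, l) * M $$ (l, j)))"
    using Suc.IH assms(1) by (simp add: sum_distrib_right mult.assoc)
  also have "\<dots> = (\<Sum>i < n. \<Sum>l < n. level_label M k i * ((M ^\<^sub>m t) $$ (i, l) * M $$ (l, j)))"
    by (rule sum.swap)
  also have "\<dots> = (\<Sum>i < n. level_label M k i * (M ^\<^sub>m Suc t) $$ (i, j))"
    by (intro sum.cong refl) (simp add: e sum_distrib_left del: pow_mat.simps)
  finally show ?case .
qed

lemma unbounded_labels_primitive:
  assumes "primitive_mat D" "2 \<le> dim_row D"
  shows "\<not> bounded_labels (mat_diagram D)"
proof
  let ?n = "dim_row D"
  have D: "D \<in> carrier_mat ?n ?n" using assms(1) by (auto simp: primitive_mat_def)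
  obtain t where t: "\<And>i j. i < ?n \<Longrightarrow> j < ?n \<Longrightarrow> 0 < (D ^\<^sub>m t) $$ (i, j)"
    using assms(1) unfolding primitive_mat_def by blast
  have low: "q < level_label D (q * t) j" if "j < ?n" for q j
    using that
  proof (induction q arbitrary: j)
    case (Suc q)
    have "Suc (Suc q) \<le> ?n * Suc q"
      using mult_le_mono1[OF assms(2), of "Suc q"] by simp
    also have "?n * Suc q = (\<Sum>i < ?n. Suc q)" by simp
    also have "\<dots> \<le> (\<Sum>i < ?n. level_label D (q * t) i * (D ^\<^sub>m t) $$ (i, j))"
    proof (rule sum_mono)
      fix i assume "i \<in> {..<?n}"
      then have "Suc q \<le> level_label D (q * t) i" "1 \<le> (D ^\<^sub>m t) $$ (i, j)"
        using Suc.IH[of i] t[of i j] Suc.prems by (auto simp: Suc_le_eq)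
      then show "Suc q \<le> level_label D (q * t) i * (D ^\<^sub>m t) $$ (i, j)"
        using mult_le_mono by fastforce
    qed
    also have "\<dots> = level_label D (Suc q * t) j"
      using level_label_add[OF D Suc.prems, of "q * t" t] by (simp add: add.commute)
    finally show ?case by simp
  qed simp
  assume "bounded_labels (mat_diagram D)"
  then obtain b where b: "\<And>k j. j < ?n \<Longrightarrow> level_label D k j \<le> b"
    unfolding bounded_labels_def mat_diagram_def by auto
  show False using low[of 0 b] b[of 0 "b * t"] assms(2) by (simp add: leD)
qed

lemma trivial_substitution_mat:
  "is_substitution_mat 1 (1\<^sub>m 1)" "primitive_mat (1\<^sub>m 1)"
proof -
  show "is_substitution_mat 1 (1\<^sub>m 1)"
    unfolding is_substitution_mat_def
    by (intro exI[of _ "[0]"] exI[of _ "\<lambda>_. [0]"])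
      (auto simp: symbolic_substitution_def substitution_mat_def)
  show "primitive_mat (1\<^sub>m 1)"
    unfolding primitive_mat_def by (auto intro!: exI[of _ 1])
qed

lemma trivial_substitution_excluded:
  assumes "2 \<le> m" "is_substitution_mat m D" "primitive_mat D"
  shows "\<not> telescope_equivalent (mat_diagram (1\<^sub>m 1)) (mat_diagram D)"
proof -
  have "level_label (1\<^sub>m 1) k 0 = 1" for k by (induction k) auto
  then have "bounded_labels (mat_diagram (1\<^sub>m 1))"
    by (auto simp: bounded_labels_def mat_diagram_def)
  moreover have "dim_row D = m"
    using assms(2) by (auto simp: is_substitution_mat_def substitution_mat_def)
  ultimately show ?thesis
    using bounded_labels_telescope_equivalent unbounded_labels_primitive assms by blast
qed

end

theory Submission
  imports Defs "HOL-Library.Countable"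
begin

text \<open>The proof splits a vertex into several copies.  Since \<open>M\<close> is primitive and is not the matrix
  \<open>(1)\<close>, the entries of its powers grow without bound
  (\<open>primitive_power_entries_unbounded\<close>), so that some power \<open>N = M\<^sup>k\<close> has all entries larger than
  \<open>m - n\<close>.  Its first row is then a sum of \<open>m - n + 1\<close> strictly positive rows.  Replacing the first
  row by these summands gives a positive \<open>m \<times> n\<close> matrix \<open>B\<close>, and \<open>N = A B\<close>, where the
  \<open>n \<times> m\<close> matrix \<open>A\<close> of zeros and ones adds the summands up again (\<open>split_first_row\<close>).  Every
  column of \<open>A\<close> contains exactly one 1.  The matrix \<open>D = B A\<close> is the required one: it is positive,
  hence primitive.

  The two diagrams are linked by the diagram whose transition matrices are \<open>A, B, A, B, \<dots>\<close>
  (\<open>telescope_moves_swap_factors\<close>).  Its even levels form the diagram of \<open>A B = M\<^sup>k\<close>, which is also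
  a telescoping of the diagram of \<open>M\<close>; its odd levels carry the transition matrices \<open>B A = D\<close>.  The
  labels at level 1 are the column sums of \<open>A\<close>, so they are all 1 and the odd levels form the diagram
  of \<open>D\<close>, labels included.

  All of this rests on one fact about diagrams, \<open>bratteli_iso_telescoping_seq_diagram\<close>: telescoping
  multiplies the transition matrices.  A product of matrices counts the paths between two vertices, and
  a diagram is determined up to isomorphism by its labels and its numbers of edges
  (\<open>bratteli_iso_by_counting\<close>).\<close>

section \<open>Diagrams given by a sequence of matrices\<close>

primrec seq_label :: "(nat \<Rightarrow> nat mat) \<Rightarrow> nat \<Rightarrow> nat \<Rightarrow> nat" where
  "seq_label T 0 j = 1"
| "seq_label T (Suc k) j = (\<Sum>i < dim_row (T k). seq_label T k i * T k $$ (i, j))"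

text \<open>The matrix \<open>T k\<close> describes the edges from level \<open>k\<close> to level \<open>k + 1\<close>.  Vertices \<open>(k, i)\<close> and
  edges \<open>(k, i, j, c)\<close> have the same meaning as in \<^const>\<open>mat_diagram\<close>, but are encoded as natural
  numbers, the type on which \<^const>\<open>telescope_move\<close> is defined.\<close>

definition seq_diagram :: "(nat \<Rightarrow> nat mat) \<Rightarrow> (nat, nat) bratteli" where
  "seq_diagram T = \<lparr>
     verts = (\<lambda>k. (\<lambda>i. to_nat (k, i)) ` {..<dim_row (T k)}),
     edges = (\<lambda>k. to_nat ` {(k', i, j, c). k' = k \<and> 1 \<le> k \<and> i < dim_row (T (k - 1)) \<and>
       j < dim_col (T (k - 1)) \<and> c < T (k - 1) $$ (i, j)}),
     rng = (\<lambda>e. case from_nat e of (k :: nat, i :: nat, j :: nat, c :: nat) \<Rightarrow> to_nat (k, j)),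
     src = (\<lambda>e. case from_nat e of (k :: nat, i :: nat, j :: nat, c :: nat) \<Rightarrow> to_nat (k - 1, i)),
     lab = (\<lambda>v. case from_nat v of (k :: nat, i :: nat) \<Rightarrow> seq_label T k i)\<rparr>"

definition bratteli_matrices :: "(nat \<Rightarrow> nat mat) \<Rightarrow> bool" where
  "bratteli_matrices T \<longleftrightarrow> (\<forall>k. 0 < dim_row (T k) \<and> dim_col (T k) = dim_row (T (Suc k)) \<and>
     (\<forall>i < dim_row (T k). \<exists>j < dim_col (T k). T k $$ (i, j) \<noteq> 0) \<and>
     (\<forall>j < dim_col (T k). \<exists>i < dim_row (T k). T k $$ (i, j) \<noteq> 0))"

lemma bratteli_matricesD:
  assumes "bratteli_matrices T"
  shows "0 < dim_row (T k)" "dim_col (T k) = dim_row (T (Suc k))"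
    "i < dim_row (T k) \<Longrightarrow> \<exists>j < dim_row (T (Suc k)). 0 < T k $$ (i, j)"
    "j < dim_row (T (Suc k)) \<Longrightarrow> \<exists>i < dim_row (T k). 0 < T k $$ (i, j)"
proof -
  show c: "dim_col (T k) = dim_row (T (Suc k))" and "0 < dim_row (T k)"
    using assms unfolding bratteli_matrices_def by blast+
  show "i < dim_row (T k) \<Longrightarrow> \<exists>j < dim_row (T (Suc k)). 0 < T k $$ (i, j)"
    "j < dim_row (T (Suc k)) \<Longrightarrow> \<exists>i < dim_row (T k). 0 < T k $$ (i, j)"
    using assms unfolding bratteli_matrices_def c neq0_conv by metis+
qed

lemma seq_label_pos:
  assumes "bratteli_matrices T" "j < dim_row (T k)"
  shows "0 < seq_label T k j"
  using assms(2)
proof (induction k arbitrary: j)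
  case (Suc k)
  obtain i where "i < dim_row (T k)" "0 < T k $$ (i, j)"
    using bratteli_matricesD(4)[OF assms(1) Suc.prems] by blast
  then show ?case using Suc.IH[of i] by (auto intro!: sum_pos2[of _ i])
qed simp

lemma verts_seq_diagram: "verts (seq_diagram T) k = (\<lambda>i. to_nat (k, i)) ` {..<dim_row (T k)}"
  and lab_seq_diagram: "lab (seq_diagram T) (to_nat (k, i)) = seq_label T k i"
  and src_seq_diagram: "src (seq_diagram T) (to_nat (k, i, j :: nat, c :: nat)) = to_nat (k - 1, i)"
  and rng_seq_diagram: "rng (seq_diagram T) (to_nat (k, i :: nat, j, c :: nat)) = to_nat (k, j)"
  and edges_seq_diagram_0: "edges (seq_diagram T) 0 = {}"
  and edges_seq_diagram_Suc: "edges (seq_diagram T) (Suc k) =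
    (\<lambda>(i, j, c :: nat). to_nat (Suc k, i, j, c)) `
      (SIGMA i:{..<dim_row (T k)}. SIGMA j:{..<dim_col (T k)}. {..<T k $$ (i, j)})"
  by (auto simp: seq_diagram_def image_iff)

lemmas seq_diagram_simps = verts_seq_diagram lab_seq_diagram src_seq_diagram rng_seq_diagram
  edges_seq_diagram_0 edges_seq_diagram_Suc

lemma edges_between_seq_diagram:
  assumes "i < dim_row (T k)" "j < dim_col (T k)"
  shows "{e \<in> edges (seq_diagram T) (Suc k).
      src (seq_diagram T) e = to_nat (k, i) \<and> rng (seq_diagram T) e = to_nat (Suc k, j)}
    = (\<lambda>c :: nat. to_nat (Suc k, i, j, c)) ` {..<T k $$ (i, j)}"
  using assms by (auto simp: seq_diagram_simps)

lemma card_edges_between_seq_diagram: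
  assumes "i < dim_row (T k)" "j < dim_col (T k)"
  shows "card {e \<in> edges (seq_diagram T) (Suc k).
      src (seq_diagram T) e = to_nat (k, i) \<and> rng (seq_diagram T) e = to_nat (Suc k, j)}
    = T k $$ (i, j)"
  using assms by (subst edges_between_seq_diagram) (simp_all add: card_image inj_on_def)

lemma bratteli_diagram_seq_diagram:
  assumes T: "bratteli_matrices T"
  shows "bratteli_diagram (seq_diagram T)"
proof -
  let ?B = "seq_diagram T"
  note D = bratteli_matricesD[OF T]
  have ex: "\<exists>e \<in> edges ?B (Suc k). src ?B e = to_nat (k, i) \<and> rng ?B e = to_nat (Suc k, j)"
    if "i < dim_row (T k)" "j < dim_row (T (Suc k))" "0 < T k $$ (i, j)" for k i j
    using that D(2)[of k]
    by (intro bexI[of _ "to_nat (Suc k, i, j, 0 :: nat)"]) (auto simp: seq_diagram_simps)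
  have out: "\<exists>e \<in> edges ?B (Suc k). src ?B e = v" if v: "v \<in> verts ?B k" for k v
  proof -
    obtain i where i: "v = to_nat (k, i)" "i < dim_row (T k)"
      using v by (auto simp: seq_diagram_simps)
    then show ?thesis using D(3)[OF i(2)] ex by metis
  qed
  have into: "\<exists>e \<in> edges ?B (Suc k). rng ?B e = v" if v: "v \<in> verts ?B (Suc k)" for k v
  proof -
    obtain j where j: "v = to_nat (Suc k, j)" "j < dim_row (T (Suc k))"
      using v by (auto simp: seq_diagram_simps)
    then show ?thesis using D(4)[OF j(2)] ex by metis
  qed
  have ne: "verts ?B k \<noteq> {}" for k
    using D(1)[of k] by (auto simp: seq_diagram_simps)
  have fin: "finite (edges ?B k)" for k
    by (cases k) (auto simp: seq_diagram_simps intro!: finite_imageI finite_SigmaI)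
  have lev: "src ?B e \<in> verts ?B k \<and> rng ?B e \<in> verts ?B (Suc k)"
    if "e \<in> edges ?B (Suc k)" for e k
    using that D(2)[of k] by (auto simp: seq_diagram_simps)
  have labels: "lab ?B v = (\<Sum>e | e \<in> (\<Union>k. edges ?B k) \<and> rng ?B e = v. lab ?B (src ?B e))"
    if v: "v \<in> verts ?B (Suc k)" for k v
  proof -
    obtain j where j: "v = to_nat (Suc k, j)" "j < dim_col (T k)"
      using v D(2)[of k] by (auto simp: seq_diagram_simps)
    have eq: "{e. e \<in> (\<Union>k. edges ?B k) \<and> rng ?B e = v}
          = (\<lambda>(i, c). to_nat (Suc k, i, j, c)) ` (SIGMA i:{..<dim_row (T k)}. {..<T k $$ (i, j)})"
      (is "?L = ?R")
    proof (intro equalityI subsetI)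
      fix e assume "e \<in> ?L"
      then obtain l where l: "e \<in> edges ?B l" "rng ?B e = v" by blast
      then show "e \<in> ?R" using j by (cases l) (auto simp: seq_diagram_simps image_iff)
    next
      fix e assume "e \<in> ?R"
      then have "e \<in> edges ?B (Suc k)" "rng ?B e = v"
        using j by (auto simp: seq_diagram_simps image_iff)
      then show "e \<in> ?L" by blast
    qed
    have "(\<Sum>e | e \<in> (\<Union>k. edges ?B k) \<and> rng ?B e = v. lab ?B (src ?B e))
          = (\<Sum>(i, c) \<in> (SIGMA i:{..<dim_row (T k)}. {..<T k $$ (i, j)}). seq_label T k i)"
      unfolding eq by (subst sum.reindex) (auto simp: inj_on_def seq_diagram_simps intro!: sum.cong)
    also have "\<dots> = (\<Sum>i < dim_row (T k). \<Sum>c < T k $$ (i, j). seq_label T k i)"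
      by (subst sum.Sigma) auto
    finally show ?thesis using j by (simp add: seq_diagram_simps mult.commute)
  qed
  have pos: "0 < lab ?B v" if "v \<in> verts ?B k" for v k
    using that seq_label_pos[OF T] by (auto simp: seq_diagram_simps)
  have disjV: "disjoint_family (verts ?B)"
    by (auto simp: disjoint_family_on_def seq_diagram_simps)
  have disjE: "disjoint_family (edges ?B)"
    unfolding disjoint_family_on_def
  proof (intro ballI impI)
    fix k l :: nat assume "k \<noteq> l"
    then show "edges ?B k \<inter> edges ?B l = {}"
      by (cases k; cases l) (auto simp: seq_diagram_simps)
  qed
  have edge: "edges ?B (Suc k) \<noteq> {}" for k using ne[of k] out by blast
  show ?thesis
    unfolding bratteli_diagram_def
  proof (intro conjI allI ballI impI)
    fix k :: nat
    show "finite (verts ?B k)" by (simp add: seq_diagram_simps)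
    show "\<exists>e \<in> (\<Union>k. edges ?B k). src ?B e = v" if "v \<in> verts ?B k" for v
      using out[OF that] by blast
    assume "1 \<le> k"
    then obtain l where l: "k = Suc l" by (cases k) auto
    show "edges ?B k \<noteq> {}" using edge l by simp
    show "src ?B e \<in> verts ?B (k - 1)" "rng ?B e \<in> verts ?B k" if "e \<in> edges ?B k" for e
      using lev[of e l] that l by simp_all
    show "\<exists>e \<in> (\<Union>k. edges ?B k). rng ?B e = v" if "v \<in> verts ?B k" for v
      using into[of v l] that l by blast
    show "lab ?B v = (\<Sum>e | e \<in> (\<Union>k. edges ?B k) \<and> rng ?B e = v. lab ?B (src ?B e))"
      if "v \<in> verts ?B k" for v
      using labels[of v l] that l by simp
  qed (use disjV disjE ne fin pos edges_seq_diagram_0[of T] in auto)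
qed

lemma seq_label_const: "seq_label (\<lambda>_. M) k j = level_label M k j"
  by (induction k arbitrary: j) auto

lemma bratteli_iso_mat_diagram_seq_diagram:
  assumes "square_mat M"
  shows "bratteli_iso (mat_diagram M) (seq_diagram (\<lambda>_. M))" (is ?there)
    and "bratteli_iso (seq_diagram (\<lambda>_. M)) (mat_diagram M)" (is ?back)
proof -
  let ?B = "mat_diagram M" and ?C = "seq_diagram (\<lambda>_. M)"
  have V: "verts ?C k = to_nat ` verts ?B k" and E: "edges ?C k = to_nat ` edges ?B k" for k
    using assms by (auto simp: mat_diagram_def seq_diagram_def image_iff)
  have end_points: "rng ?C (to_nat e) = to_nat (rng ?B e)" "src ?C (to_nat e) = to_nat (src ?B e)" for e
    by (auto simp: mat_diagram_def seq_diagram_def split: prod.split)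
  have lab: "lab ?C (to_nat v) = lab ?B v" for v
    by (auto simp: mat_diagram_def seq_diagram_def seq_label_const split: prod.split)
  have bij: "bij_betw to_nat A (to_nat ` A)" "bij_betw from_nat (to_nat ` A) A"
    for A :: "'z :: countable set"
    by (auto simp: bij_betw_def inj_on_def image_image)
  show ?there unfolding bratteli_iso_def V E
    by (intro exI[of _ to_nat]) (auto simp: bij end_points lab)
  show ?back unfolding bratteli_iso_def V E
    by (intro exI[of _ from_nat]) (auto simp: bij end_points lab)
qed


section \<open>Isomorphism from edge counts\<close>

text \<open>Edges with the same source and range are interchangeable: bijections between such classes of
  parallel edges, which exist because the numbers agree, are glued to a bijection of all edges.\<close>

lemma bratteli_iso_by_counting:
  assumes vertex_bij: "\<And>n. bij_betw f (verts B n) (verts C n)"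
    and labels: "\<And>n v. v \<in> verts B n \<Longrightarrow> lab C (f v) = lab B v"
    and disj: "disjoint_family (edges B)"
    and none: "edges B 0 = {}" "edges C 0 = {}"
    and fin: "\<And>n. finite (edges B n)" "\<And>n. finite (edges C n)"
    and endsB: "\<And>n e. e \<in> edges B (Suc n) \<Longrightarrow> src B e \<in> verts B n \<and> rng B e \<in> verts B (Suc n)"
    and endsC: "\<And>n e. e \<in> edges C (Suc n) \<Longrightarrow> src C e \<in> verts C n \<and> rng C e \<in> verts C (Suc n)"
    and count: "\<And>n u v. u \<in> verts B n \<Longrightarrow> v \<in> verts B (Suc n) \<Longrightarrow>
      card {e \<in> edges B (Suc n). src B e = u \<and> rng B e = v}
      = card {e \<in> edges C (Suc n). src C e = f u \<and> rng C e = f v}"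
  shows "bratteli_iso B C"
proof -
  define EB where "EB n u v = {e \<in> edges B (Suc n). src B e = u \<and> rng B e = v}" for n u v
  define EC where "EC n u v = {e \<in> edges C (Suc n). src C e = u \<and> rng C e = v}" for n u v
  have "\<forall>n u v. \<exists>h. u \<in> verts B n \<longrightarrow> v \<in> verts B (Suc n) \<longrightarrow> bij_betw h (EB n u v) (EC n (f u) (f v))"
    using count fin by (auto intro!: finite_same_card_bij simp: EB_def EC_def)
  then obtain h where h: "\<And>n u v. u \<in> verts B n \<Longrightarrow> v \<in> verts B (Suc n) \<Longrightarrow>
      bij_betw (h n u v) (EB n u v) (EC n (f u) (f v))"
    by metis
  (* An edge determines its level, so one function can act on the edges of all levels. *)
  define level where "level e = (THE n. e \<in> edges B (Suc n))" for e
  have level: "level e = n" if "e \<in> edges B (Suc n)" for e n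
    unfolding level_def using that disj unfolding disjoint_family_on_def
    by (intro the_equality) blast+
  define g where "g e = h (level e) (src B e) (rng B e) e" for e
  have gh: "g e = h n (src B e) (rng B e) e" if "e \<in> edges B (Suc n)" for e n
    using level[OF that] by (simp add: g_def)
  have g_in: "g e \<in> EC n (f (src B e)) (f (rng B e))" if e: "e \<in> edges B (Suc n)" for e n
  proof -
    have "e \<in> EB n (src B e) (rng B e)" using e by (simp add: EB_def)
    then show ?thesis using h endsB[OF e] gh[OF e] bij_betwE by metis
  qed
  have f_inj: "u = v" if "f u = f v" "u \<in> verts B n" "v \<in> verts B n" for u v n
    using that vertex_bij[of n] by (meson bij_betw_imp_inj_on inj_onD)
  have "bij_betw g (edges B (Suc n)) (edges C (Suc n))" for n
  proof (intro bij_betw_imageI inj_onI equalityI subsetI)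
    fix d e assume d: "d \<in> edges B (Suc n)" and e: "e \<in> edges B (Suc n)" and eq: "g d = g e"
    have "f (src B d) = f (src B e)" "f (rng B d) = f (rng B e)"
      using g_in[OF d] g_in[OF e] eq by (auto simp: EC_def)
    then have s: "src B d = src B e" and r: "rng B d = rng B e"
      using f_inj endsB[OF d] endsB[OF e] by blast+
    have "d \<in> EB n (src B e) (rng B e)" "e \<in> EB n (src B e) (rng B e)"
      using d e s r by (auto simp: EB_def)
    moreover have "inj_on (h n (src B e) (rng B e)) (EB n (src B e) (rng B e))"
      using h endsB[OF e] bij_betw_imp_inj_on by blast
    ultimately show "d = e" using eq gh[OF d] gh[OF e] s r by (metis inj_onD)
  next
    fix e assume "e \<in> g ` edges B (Suc n)"
    then show "e \<in> edges C (Suc n)" using g_in by (auto simp: EC_def)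
  next
    fix e assume e: "e \<in> edges C (Suc n)"
    have "src C e \<in> f ` verts B n" "rng C e \<in> f ` verts B (Suc n)"
      using endsC[OF e] by (simp_all add: bij_betw_imp_surj_on[OF vertex_bij])
    then obtain u v where uv: "u \<in> verts B n" "v \<in> verts B (Suc n)" "src C e = f u" "rng C e = f v"
      by blast
    then have "e \<in> h n u v ` EB n u v"
      using e h[of u n v] by (auto simp: EC_def bij_betw_def)
    then show "e \<in> g ` edges B (Suc n)" using gh by (auto simp: EB_def)
  qed
  then have bij: "bij_betw g (edges B n) (edges C n)" for n
    using none by (cases n) (auto simp: bij_betw_def)
  have "rng C (g e) = f (rng B e) \<and> src C (g e) = f (src B e)" if "e \<in> edges B n" for n e
    using that none g_in by (cases n) (auto simp: EC_def)
  then show ?thesis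
    unfolding bratteli_iso_def using vertex_bij bij labels by (intro exI[of _ f] exI[of _ g]) blast
qed


section \<open>Counting paths\<close>

text \<open>The empty path has no end points of its own.  The case distinction lets it start and end at the
  same vertex, which makes the identity matrix the base of the induction that counts paths.\<close>

definition paths_between :: "('v, 'e) bratteli \<Rightarrow> nat \<Rightarrow> nat \<Rightarrow> 'v \<Rightarrow> 'v \<Rightarrow> 'e list set" where
  "paths_between B k t u v = {es \<in> paths B k (k + t).
     if t = 0 then u = v else src B (hd es) = u \<and> rng B (last es) = v}"

lemma bratteli_edge_ends:
  assumes "bratteli_diagram B" "e \<in> edges B (Suc k)"
  shows "src B e \<in> verts B k" "rng B e \<in> verts B (Suc k)"
proof -
  have "\<forall>n \<ge> 1. \<forall>e \<in> edges B n. src B e \<in> verts B (n - 1) \<and> rng B e \<in> verts B n"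
    using assms(1) unfolding bratteli_diagram_def by blast
  from this[rule_format, of "Suc k" e] assms(2)
  show "src B e \<in> verts B k" "rng B e \<in> verts B (Suc k)" by simp_all
qed

lemma finite_bratteli_edges:
  assumes "bratteli_diagram B"
  shows "finite (edges B k)"
  using assms unfolding bratteli_diagram_def by (cases "k = 0") auto

lemma paths_last_hd:
  assumes "es \<in> paths B k l" "k < l"
  shows "es \<noteq> []" "hd es \<in> edges B (Suc k)" "last es \<in> edges B l"
proof -
  have len: "length es = l - k" using assms(1) by (simp add: paths_def)
  then show ne: "es \<noteq> []" using assms(2) by auto
  have nth: "es ! i \<in> edges B (k + i + 1)" if "i < l - k" for i
    using assms(1) that by (simp add: paths_def)
  show "hd es \<in> edges B (Suc k)" using nth[of 0] ne assms(2) by (simp add: hd_conv_nth)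
  show "last es \<in> edges B l" using nth[of "l - k - 1"] ne len assms(2) by (simp add: last_conv_nth)
qed

lemma finite_paths:
  assumes "bratteli_diagram B"
  shows "finite (paths B k l)"
proof (rule finite_subset)
  show "paths B k l \<subseteq> {es. set es \<subseteq> (\<Union>n \<le> l. edges B n) \<and> length es = l - k}"
  proof
    fix es assume es: "es \<in> paths B k l"
    then have len: "length es = l - k" by (simp add: paths_def)
    have nth: "es ! i \<in> edges B (k + i + 1)" if "i < l - k" for i
      using es that by (simp add: paths_def)
    have "e \<in> (\<Union>n \<le> l. edges B n)" if e: "e \<in> set es" for e
    proof -
      obtain i where "i < length es" "e = es ! i" using e by (auto simp: in_set_conv_nth)
      then have "e \<in> edges B (k + i + 1)" "k + i + 1 \<le> l" using nth[of i] len by simp_all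
      then show ?thesis by blast
    qed
    then show "es \<in> {es. set es \<subseteq> (\<Union>n \<le> l. edges B n) \<and> length es = l - k}"
      using len by blast
  qed
  show "finite {es. set es \<subseteq> (\<Union>n \<le> l. edges B n) \<and> length es = l - k}"
    using assms finite_bratteli_edges by (intro finite_lists_length_eq) auto
qed

lemma snoc_in_paths_iff:
  "es @ [e] \<in> paths B k (k + Suc t) \<longleftrightarrow>
    es \<in> paths B k (k + t) \<and> e \<in> edges B (Suc (k + t)) \<and> (t \<noteq> 0 \<longrightarrow> rng B (last es) = src B e)"
  (is "?L \<longleftrightarrow> ?R")
proof
  assume L: ?L
  then have len: "length es = t" by (simp add: paths_def)
  have nth: "(es @ [e]) ! i \<in> edges B (k + i + 1)" if "i < Suc t" for i
    using L that by (simp add: paths_def)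
  have comp: "rng B ((es @ [e]) ! i) = src B ((es @ [e]) ! (i + 1))" if "i + 1 < Suc t" for i
    using L that by (simp add: paths_def)
  have "es ! i \<in> edges B (k + i + 1)" if "i < t" for i
    using nth[of i] that len by (simp add: nth_append)
  moreover have "rng B (es ! i) = src B (es ! (i + 1))" if "i + 1 < t" for i
    using comp[of i] that len by (simp add: nth_append)
  moreover have "e \<in> edges B (Suc (k + t))" using nth[of t] len by (simp add: nth_append)
  moreover have "rng B (last es) = src B e" if "t \<noteq> 0"
  proof -
    have "es \<noteq> []" using that len by auto
    then show ?thesis using comp[of "t - 1"] that len by (simp add: nth_append last_conv_nth)
  qed
  ultimately show ?R using len by (simp add: paths_def)
next
  assume R: ?R
  then have len: "length es = t" by (simp add: paths_def)
  have "(es @ [e]) ! i \<in> edges B (k + i + 1)" if "i < Suc t" for i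
    using R that len by (cases "i = t") (auto simp: paths_def nth_append)
  moreover have "rng B ((es @ [e]) ! i) = src B ((es @ [e]) ! (i + 1))" if "i + 1 < Suc t" for i
  proof (cases "i + 1 = t")
    case True
    have "es \<noteq> []" using True len by auto
    then have "last es = es ! i" using True len by (auto simp: last_conv_nth)
    then show ?thesis using True R len by (auto simp: nth_append)
  next
    case False
    then show ?thesis using R that len by (auto simp: paths_def nth_append)
  qed
  ultimately show ?L using len by (simp add: paths_def)
qed

text \<open>A path of length \<open>t + 1\<close> is cut before its last edge, at the vertex \<open>w\<close>.  Summed over \<open>w\<close>, the
  numbers of the two parts multiply, which is the rule for the product of two matrices.\<close>

lemma paths_between_Suc:
  assumes B: "bratteli_diagram B" and u: "u \<in> verts B k"
  shows "paths_between B k (Suc t) u v = (\<Union>w \<in> verts B (k + t).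
    (\<lambda>(es, e). es @ [e]) `
      (paths_between B k t u w \<times> {e \<in> edges B (Suc (k + t)). src B e = w \<and> rng B e = v}))"
    (is "?L = ?R")
proof (intro equalityI subsetI)
  fix p assume p: "p \<in> ?L"
  then have "length p = Suc t" by (simp add: paths_between_def paths_def)
  then obtain es e where pe: "p = es @ [e]" by (metis append_butlast_last_id length_0_conv nat.distinct(1))
  then have es: "es \<in> paths B k (k + t)" and e: "e \<in> edges B (Suc (k + t))"
    and join: "t \<noteq> 0 \<longrightarrow> rng B (last es) = src B e"
    and start: "src B (hd (es @ [e])) = u" and "rng B e = v"
    using p snoc_in_paths_iff[of es e B k t] by (auto simp: paths_between_def)
  have "es \<in> paths_between B k t u (src B e)"
  proof (cases "t = 0")
    case True
    then show ?thesis using es start by (auto simp: paths_between_def paths_def)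
  next
    case False
    then have "es \<noteq> []" using es by (auto simp: paths_def)
    then show ?thesis using es start join False by (simp add: paths_between_def)
  qed
  then show "p \<in> ?R"
    using pe e \<open>rng B e = v\<close> bratteli_edge_ends(1)[OF B e] by auto
next
  fix p assume "p \<in> ?R"
  then obtain es e where pe: "p = es @ [e]" and es: "es \<in> paths_between B k t u (src B e)"
    and e: "e \<in> edges B (Suc (k + t))" "rng B e = v" by auto
  have path: "p \<in> paths B k (k + Suc t)"
    unfolding pe snoc_in_paths_iff using es e by (auto simp: paths_between_def split: if_splits)
  have "src B (hd p) = u"
  proof (cases "t = 0")
    case True
    then show ?thesis using es pe by (auto simp: paths_between_def paths_def)
  next
    case False
    then have "es \<noteq> []" using es by (auto simp: paths_between_def paths_def)
    then show ?thesis using es pe False by (simp add: paths_between_def)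
  qed
  then show "p \<in> ?L" using path pe e by (simp add: paths_between_def)
qed

lemma card_paths_between_Suc:
  assumes B: "bratteli_diagram B" and u: "u \<in> verts B k"
  shows "card (paths_between B k (Suc t) u v) = (\<Sum>w \<in> verts B (k + t).
    card (paths_between B k t u w) * card {e \<in> edges B (Suc (k + t)). src B e = w \<and> rng B e = v})"
proof -
  let ?E = "\<lambda>w. {e \<in> edges B (Suc (k + t)). src B e = w \<and> rng B e = v}"
  have fin: "finite (paths_between B k t u w)" "finite (?E w)" for w
    using finite_paths[OF B] finite_bratteli_edges[OF B] by (auto simp: paths_between_def)
  have "finite (verts B (k + t))" using B unfolding bratteli_diagram_def by blast
  then have "card (paths_between B k (Suc t) u v) = (\<Sum>w \<in> verts B (k + t).
      card ((\<lambda>(es, e). es @ [e]) ` (paths_between B k t u w \<times> ?E w)))"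
    unfolding paths_between_Suc[OF B u] using fin by (intro card_UN_disjoint) auto
  also have "\<dots> = (\<Sum>w \<in> verts B (k + t). card (paths_between B k t u w \<times> ?E w))"
    by (intro sum.cong refl card_image) (auto simp: inj_on_def)
  finally show ?thesis by (simp add: card_cartesian_product)
qed

primrec transit :: "(nat \<Rightarrow> nat mat) \<Rightarrow> nat \<Rightarrow> nat \<Rightarrow> nat mat" where
  "transit T k 0 = 1\<^sub>m (dim_row (T k))"
| "transit T k (Suc t) = transit T k t * T (k + t)"

lemma dim_transit:
  assumes "bratteli_matrices T"
  shows "dim_row (transit T k t) = dim_row (T k)" "dim_col (transit T k t) = dim_row (T (k + t))"
  using bratteli_matricesD(2)[OF assms] by (induction t) auto

lemma transit_Suc_index:
  assumes T: "bratteli_matrices T" and "i < dim_row (T k)" "j < dim_row (T (Suc (k + t)))"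
  shows "transit T k (Suc t) $$ (i, j)
    = (\<Sum>l < dim_row (T (k + t)). transit T k t $$ (i, l) * T (k + t) $$ (l, j))"
  using assms(2,3) bratteli_matricesD(2)[OF T, of "k + t"]
  by (simp add: dim_transit[OF T] scalar_prod_def atLeast0LessThan)

lemma card_paths_between_seq_diagram:
  assumes T: "bratteli_matrices T" and i: "i < dim_row (T k)" and "j < dim_row (T (k + t))"
  shows "card (paths_between (seq_diagram T) k t (to_nat (k, i)) (to_nat (k + t, j)))
    = transit T k t $$ (i, j)"
  using assms(3)
proof (induction t arbitrary: j)
  case 0
  have "paths (seq_diagram T) k k = {[]}" by (simp add: paths_def)
  then have "paths_between (seq_diagram T) k 0 (to_nat (k, i)) (to_nat (k, j)) = (if i = j then {[]} else {})"
    by (simp add: paths_between_def)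
  then show ?case using 0 i by simp
next
  case (Suc t)
  let ?B = "seq_diagram T"
  have B: "bratteli_diagram ?B" by (rule bratteli_diagram_seq_diagram[OF T])
  have u: "to_nat (k, i) \<in> verts ?B k" using i by (simp add: seq_diagram_simps)
  have "card (paths_between ?B k (Suc t) (to_nat (k, i)) (to_nat (k + Suc t, j)))
    = (\<Sum>l < dim_row (T (k + t)).
        card (paths_between ?B k t (to_nat (k, i)) (to_nat (k + t, l))) *
        card {e \<in> edges ?B (Suc (k + t)). src ?B e = to_nat (k + t, l) \<and> rng ?B e = to_nat (Suc (k + t), j)})"
    unfolding card_paths_between_Suc[OF B u] verts_seq_diagram
    by (subst sum.reindex) (auto simp: inj_on_def)
  also have "\<dots> = (\<Sum>l < dim_row (T (k + t)). transit T k t $$ (i, l) * T (k + t) $$ (l, j))"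
    using Suc.prems bratteli_matricesD(2)[OF T, of "k + t"]
    by (intro sum.cong refl) (simp add: Suc.IH card_edges_between_seq_diagram)
  also have "\<dots> = transit T k (Suc t) $$ (i, j)"
    using transit_Suc_index[OF T i] Suc.prems by simp
  finally show ?case .
qed

text \<open>The labels of a level, as a row vector, are multiplied from the right by the transition matrices.
  Hence labels of a telescoping obey the recursion for the products.\<close>

lemma seq_label_add:
  assumes T: "bratteli_matrices T" and "j < dim_row (T (k + t))"
  shows "seq_label T (k + t) j = (\<Sum>i < dim_row (T k). seq_label T k i * transit T k t $$ (i, j))"
  using assms(2)
proof (induction t arbitrary: j)
  case 0
  have "(\<Sum>i < dim_row (T k). seq_label T k i * transit T k 0 $$ (i, j))
    = (\<Sum>i < dim_row (T k). if i = j then seq_label T k i else 0)"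
    using 0 by (intro sum.cong) auto
  then show ?case using 0 by simp
next
  case (Suc t)
  have "seq_label T (k + Suc t) j
    = (\<Sum>l < dim_row (T (k + t)). \<Sum>i < dim_row (T k).
        seq_label T k i * (transit T k t $$ (i, l) * T (k + t) $$ (l, j)))"
    using Suc.IH by (simp add: sum_distrib_right mult.assoc)
  also have "\<dots> = (\<Sum>i < dim_row (T k). \<Sum>l < dim_row (T (k + t)).
        seq_label T k i * (transit T k t $$ (i, l) * T (k + t) $$ (l, j)))"
    by (rule sum.swap)
  also have "\<dots> = (\<Sum>i < dim_row (T k). seq_label T k i * transit T k (Suc t) $$ (i, j))"
    using Suc.prems
    by (intro sum.cong refl) (simp add: transit_Suc_index[OF T] sum_distrib_left del: transit.simps)
  finally show ?case .
qed


section \<open>Telescoping multiplies the matrices\<close>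

lemma bratteli_matrices_transit:
  assumes T: "bratteli_matrices T" and S: "\<And>q. S q = transit T (m q) (m (Suc q) - m q)"
    and m: "strict_mono m"
  shows "bratteli_matrices S"
proof -
  have rows: "\<exists>j < dim_row (T (k + t)). 0 < transit T k t $$ (i, j)" if i: "i < dim_row (T k)" for i k t
  proof (induction t)
    case (Suc t)
    then obtain l where l: "l < dim_row (T (k + t))" "0 < transit T k t $$ (i, l)" by blast
    then obtain j where j: "j < dim_row (T (Suc (k + t)))" "0 < T (k + t) $$ (l, j)"
      using bratteli_matricesD(3)[OF T] by blast
    have "0 < transit T k (Suc t) $$ (i, j)"
      unfolding transit_Suc_index[OF T i j(1)] using l j by (intro sum_pos2[of _ l]) auto
    then show ?case using j by auto
  qed (use i in auto)
  have cols: "\<exists>i < dim_row (T k). 0 < transit T k t $$ (i, j)" if "j < dim_row (T (k + t))" for j k t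
    using that
  proof (induction t arbitrary: j)
    case (Suc t)
    then have j: "j < dim_row (T (Suc (k + t)))" by simp
    obtain l where l: "l < dim_row (T (k + t))" "0 < T (k + t) $$ (l, j)"
      using bratteli_matricesD(4)[OF T j] by blast
    then obtain i where i: "i < dim_row (T k)" "0 < transit T k t $$ (i, l)" using Suc.IH by blast
    have "0 < transit T k (Suc t) $$ (i, j)"
      unfolding transit_Suc_index[OF T i(1) j] using l i by (intro sum_pos2[of _ l]) auto
    then show ?case using i by auto
  qed auto
  have level: "m q + (m (Suc q) - m q) = m (Suc q)" for q using m by (simp add: strict_mono_less_eq)
  then have "\<exists>j < dim_row (T (m (Suc q))). 0 < transit T (m q) (m (Suc q) - m q) $$ (i, j)"
    if "i < dim_row (T (m q))" for i q
    using rows[OF that, of "m (Suc q) - m q"] by simp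
  moreover have "\<exists>i < dim_row (T (m q)). 0 < transit T (m q) (m (Suc q) - m q) $$ (i, j)"
    if "j < dim_row (T (m (Suc q)))" for j q
    using cols[of j "m q" "m (Suc q) - m q"] that level[of q] by simp
  ultimately show ?thesis
    unfolding bratteli_matrices_def using bratteli_matricesD(1)[OF T]
    by (simp add: S dim_transit[OF T] level)
qed

text \<open>The telescoping may start at a level \<open>m 0 > 0\<close>.  Its labels there must be 1, because those of
  \<open>seq_diagram S\<close> start with 1; above that level the transition matrices determine the labels.\<close>

lemma bratteli_iso_telescoping_seq_diagram:
  assumes T: "bratteli_matrices T" and m: "strict_mono m"
    and step: "\<And>q. S q = transit T (m q) (m (Suc q) - m q)"
    and unit_labels: "\<And>i. i < dim_row (T (m 0)) \<Longrightarrow> seq_label T (m 0) i = 1"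
  shows "bratteli_iso (telescoping m (seq_diagram T)) (seq_diagram S)"
proof -
  have S: "bratteli_matrices S" using bratteli_matrices_transit[OF T step m] .
  let ?B = "seq_diagram T" and ?C = "seq_diagram S"
  let ?X = "telescoping m ?B"
  define f where "f v = (case from_nat v of (k :: nat, i :: nat) \<Rightarrow> to_nat (the_inv m k, i))" for v
  have f: "f (to_nat (m q, i)) = to_nat (q, i)" for q i :: nat
    using strict_mono_imp_inj_on[OF m, of UNIV] by (simp add: f_def the_inv_f_f)
  have lt: "m q < m (Suc q)" for q using m by (simp add: strict_mono_def)
  have dim: "dim_row (S q) = dim_row (T (m q))" for q by (simp add: step dim_transit[OF T])
  have labels: "seq_label S q i = seq_label T (m q) i" if "i < dim_row (T (m q))" for q i
    using that
  proof (induction q arbitrary: i)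
    case (Suc q)
    have "m q + (m (Suc q) - m q) = m (Suc q)" using lt[of q] by simp
    then show ?case
      using seq_label_add[OF T, of i "m q" "m (Suc q) - m q"] Suc
      by (simp add: dim step[symmetric])
  qed (simp add: unit_labels)
  have B: "bratteli_diagram ?B" and C: "bratteli_diagram ?C"
    by (simp_all add: bratteli_diagram_seq_diagram T S)
  have Xe: "edges ?X (Suc q) = paths ?B (m q) (m (Suc q))" for q by (simp add: telescoping_def)
  have X0: "edges ?X 0 = {}" by (simp add: telescoping_def)
  have Xv: "verts ?X q = verts ?B (m q)" for q by (simp add: telescoping_def)
  have disj: "disjoint_family (edges ?X)"
    unfolding disjoint_family_on_def
  proof (intro ballI impI)
    fix p q :: nat assume "p \<noteq> q"
    show "edges ?X p \<inter> edges ?X q = {}"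
    proof (cases "p = 0 \<or> q = 0")
      case False
      then obtain p' q' where pq: "p = Suc p'" "q = Suc q'" using not0_implies_Suc by blast
      then have "m p' \<noteq> m q'" using \<open>p \<noteq> q\<close> m by (auto simp: strict_mono_eq)
      moreover have "disjoint_family (edges ?B)" using B unfolding bratteli_diagram_def by blast
      ultimately have "edges ?B (Suc (m p')) \<inter> edges ?B (Suc (m q')) = {}"
        unfolding disjoint_family_on_def by simp
      then show ?thesis
        unfolding pq Xe using paths_last_hd(2)[OF _ lt] by blast
    qed (auto simp: X0)
  qed
  show ?thesis
  proof (rule bratteli_iso_by_counting[where f = f])
    fix q
    show "bij_betw f (verts ?X q) (verts ?C q)"
      unfolding Xv verts_seq_diagram dim
      by (auto simp: bij_betw_def inj_on_def f image_image)
    show "lab ?C (f v) = lab ?X v" if "v \<in> verts ?X q" for v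
      using that labels by (auto simp: Xv verts_seq_diagram f lab_seq_diagram telescoping_def)
    show "finite (edges ?X q)" using finite_paths[OF B] by (simp add: telescoping_def)
    show "finite (edges ?C q)" by (rule finite_bratteli_edges[OF C])
    show "src ?C e \<in> verts ?C q \<and> rng ?C e \<in> verts ?C (Suc q)" if "e \<in> edges ?C (Suc q)" for e
      using bratteli_edge_ends[OF C that] by blast
    show "src ?X es \<in> verts ?X q \<and> rng ?X es \<in> verts ?X (Suc q)" if "es \<in> edges ?X (Suc q)" for es
    proof -
      have es: "es \<in> paths ?B (m q) (m (Suc q))" using that Xe by simp
      obtain l where l: "m (Suc q) = Suc l" using lt[of q] by (cases "m (Suc q)") auto
      show ?thesis
        using paths_last_hd(2,3)[OF es lt] bratteli_edge_ends[OF B, of "hd es" "m q"]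
          bratteli_edge_ends[OF B, of "last es" l] l
        by (simp add: telescoping_def)
    qed
    show "card {es \<in> edges ?X (Suc q). src ?X es = u \<and> rng ?X es = v}
        = card {e \<in> edges ?C (Suc q). src ?C e = f u \<and> rng ?C e = f v}"
      if uv: "u \<in> verts ?X q" "v \<in> verts ?X (Suc q)" for u v
    proof -
      let ?t = "m (Suc q) - m q"
      have t: "m q + ?t = m (Suc q)" "?t \<noteq> 0" using lt[of q] by simp_all
      obtain i j where i: "u = to_nat (m q, i)" "i < dim_row (T (m q))"
        and j: "v = to_nat (m (Suc q), j)" "j < dim_row (T (m (Suc q)))"
        using uv by (auto simp: Xv verts_seq_diagram)
      have "{es \<in> edges ?X (Suc q). src ?X es = u \<and> rng ?X es = v} = paths_between ?B (m q) ?t u v"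
        using t by (simp add: paths_between_def telescoping_def)
      also have "card \<dots> = S q $$ (i, j)"
        using card_paths_between_seq_diagram[OF T i(2), of j ?t] i j t by (simp add: step)
      also have "\<dots> = card {e \<in> edges ?C (Suc q). src ?C e = f u \<and> rng ?C e = f v}"
        using card_edges_between_seq_diagram[of i S q j] i j bratteli_matricesD(2)[OF S, of q]
        by (simp add: f dim)
      finally show ?thesis .
    qed
  qed (auto simp: disj X0 edges_seq_diagram_0)
qed

lemma telescope_move_seq_diagram:
  assumes "bratteli_matrices T" "strict_mono m"
    "\<And>q. S q = transit T (m q) (m (Suc q) - m q)"
    "\<And>i. i < dim_row (T (m 0)) \<Longrightarrow> seq_label T (m 0) i = 1"
  shows "telescope_move (seq_diagram T) (seq_diagram S)"
    and "telescope_move (seq_diagram S) (seq_diagram T)"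
  using bratteli_iso_telescoping_seq_diagram[OF assms] assms(1,2) bratteli_diagram_seq_diagram
    bratteli_matrices_transit[OF assms(1,3,2)]
  unfolding telescope_move_def by blast+


lemma telescope_equivalent_mat_diagram:
  assumes M: "bratteli_matrices (\<lambda>_. M)" and D: "bratteli_matrices (\<lambda>_. D)"
    and moves: "telescope_move\<^sup>*\<^sup>* (seq_diagram (\<lambda>_. M)) (seq_diagram (\<lambda>_. D))"
  shows "telescope_equivalent (mat_diagram M) (mat_diagram D)"
proof -
  have diagram: "bratteli_diagram (mat_diagram X)" if "bratteli_matrices (\<lambda>_. X)" for X
    using bratteli_matricesD[OF that] by (intro bratteli_diagram_mat_diagram) auto
  have "square_mat M" "square_mat D"
    using bratteli_matricesD(2)[OF M] bratteli_matricesD(2)[OF D] by auto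
  then show ?thesis
    unfolding telescope_equivalent_def
    using diagram[OF M] diagram[OF D] moves bratteli_iso_mat_diagram_seq_diagram by blast
qed


section \<open>Powers of a matrix\<close>

lemma mult_mat_index_sum:
  assumes "X \<in> carrier_mat a b" "Y \<in> carrier_mat b c" "i < a" "j < c"
  shows "(X * Y) $$ (i, j) = (\<Sum>l < b. X $$ (i, l) * Y $$ (l, j))"
  using assms by (simp add: scalar_prod_def atLeast0LessThan)

lemma transit_const: "transit (\<lambda>_. M) k t = M ^\<^sub>m t"
  by (induction t) auto

lemma telescope_move_power:
  assumes M: "bratteli_matrices (\<lambda>_. M)" and "0 < k"
  shows "telescope_move (seq_diagram (\<lambda>_. M)) (seq_diagram (\<lambda>_. M ^\<^sub>m k))"
proof -
  have m: "strict_mono ((*) k)" using assms(2) by (simp add: strict_mono_def)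
  have step: "M ^\<^sub>m k = transit (\<lambda>_. M) (k * q) (k * Suc q - k * q)" for q
    by (simp add: transit_const)
  show "telescope_move (seq_diagram (\<lambda>_. M)) (seq_diagram (\<lambda>_. M ^\<^sub>m k))"
    by (rule telescope_move_seq_diagram(1)[OF M m step]) simp
qed

text \<open>A zero row or a zero column of \<open>M\<close> would remain zero in every positive power of \<open>M\<close>.\<close>

lemma bratteli_matrices_primitive:
  assumes "primitive_mat M" "0 < dim_row M"
  shows "bratteli_matrices (\<lambda>_. M)"
proof -
  obtain n where n: "dim_row M = n" by blast
  have M: "M \<in> carrier_mat n n" using assms(1) n by (auto simp: primitive_mat_def)
  obtain k where k: "\<And>i j. i < n \<Longrightarrow> j < n \<Longrightarrow> 0 < (M ^\<^sub>m Suc k) $$ (i, j)"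
    using assms(1) n unfolding primitive_mat_def by (metis One_nat_def Suc_le_D)
  have power: "(M ^\<^sub>m Suc t) $$ (i, j) = (\<Sum>l < n. (M ^\<^sub>m t) $$ (i, l) * M $$ (l, j))"
    if "i < n" "j < n" for t i j
    using mult_mat_index_sum[OF pow_carrier_mat[OF M] M that] by simp
  have "\<exists>j < n. M $$ (i, j) \<noteq> 0" if i: "i < n" for i
  proof (rule ccontr)
    assume zero: "\<not> (\<exists>j < n. M $$ (i, j) \<noteq> 0)"
    have "(M ^\<^sub>m Suc t) $$ (i, j) = 0" if "j < n" for t j
      using that
    proof (induction t arbitrary: j)
      case 0
      then show ?case using zero i M by simp
    next
      case (Suc t)
      then show ?case unfolding power[OF i Suc.prems] by (intro sum.neutral) auto
    qed
    then show False using k[OF i i] i by simp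
  qed
  moreover have "\<exists>i < n. M $$ (i, j) \<noteq> 0" if j: "j < n" for j
  proof (rule ccontr)
    assume "\<not> (\<exists>i < n. M $$ (i, j) \<noteq> 0)"
    then have "(M ^\<^sub>m Suc k) $$ (j, j) = 0" unfolding power[OF j j] by (intro sum.neutral) auto
    then show False using k[OF j j] by simp
  qed
  ultimately show ?thesis using assms(2) M n by (simp add: bratteli_matrices_def)
qed

lemma pow_mat_add:
  assumes "M \<in> carrier_mat n n"
  shows "M ^\<^sub>m (a + b) = M ^\<^sub>m a * (M ^\<^sub>m b :: nat mat)"
proof (induction b)
  case 0
  then show ?case using assms pow_carrier_mat[OF assms, of a] by simp
next
  case (Suc b)
  then show ?case
    using assoc_mult_mat[OF pow_carrier_mat[OF assms, of a] pow_carrier_mat[OF assms, of b] assms] by simp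
qed

text \<open>Let \<open>P\<close> be a positive power of \<open>M\<close> with positive entries.  Its column sums are at least 2: either there
  are at least two rows, or \<open>P\<close> is a positive power of an integer larger than 1.  A further factor \<open>P\<close>
  therefore at least doubles the smallest entry.\<close>

lemma primitive_power_entries_unbounded:
  assumes prim: "primitive_mat M" and ne: "M \<noteq> 1\<^sub>m 1" and pos: "0 < dim_row M"
  shows "\<exists>k > 0. \<forall>i < dim_row M. \<forall>j < dim_row M. b < (M ^\<^sub>m k) $$ (i, j)"
proof -
  let ?n = "dim_row M"
  have M: "M \<in> carrier_mat ?n ?n" using prim by (auto simp: primitive_mat_def)
  obtain t where t: "1 \<le> t" "\<And>i j. i < ?n \<Longrightarrow> j < ?n \<Longrightarrow> 0 < (M ^\<^sub>m t) $$ (i, j)"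
    using prim unfolding primitive_mat_def by blast
  have col_sum: "2 \<le> (\<Sum>l < ?n. (M ^\<^sub>m t) $$ (l, j))" if j: "j < ?n" for j
  proof (cases "?n = 1")
    case True
    have "M $$ (0, 0) \<noteq> 1"
    proof
      assume "M $$ (0, 0) = 1"
      then have "M = 1\<^sub>m 1" using M True by (intro eq_matI) auto
      then show False using ne by simp
    qed
    moreover have "M $$ (0, 0) \<noteq> 0"
      using bratteli_matricesD(3)[OF bratteli_matrices_primitive[OF prim pos], of 0] True by auto
    ultimately have "2 \<le> M $$ (0, 0)" by simp
    moreover have "(M ^\<^sub>m s) $$ (0, 0) = M $$ (0, 0) ^ s" for s
    proof (induction s)
      case (Suc s)
      then show ?case
        using mult_mat_index_sum[OF pow_carrier_mat[OF M, of s] M, of 0 0] True by simp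
    qed (use True in simp)
    ultimately show ?thesis
      using True j t(1) self_le_power[of "M $$ (0, 0)" t] by simp
  next
    case False
    have "2 \<le> (\<Sum>l < ?n. 1 :: nat)" using False pos by simp
    also have "\<dots> \<le> (\<Sum>l < ?n. (M ^\<^sub>m t) $$ (l, j))"
      using t(2) j by (intro sum_mono) (simp add: Suc_le_eq)
    finally show ?thesis .
  qed
  have "q < (M ^\<^sub>m (Suc q * t)) $$ (i, j)" if "i < ?n" "j < ?n" for q i j
    using that(2)
  proof (induction q arbitrary: j)
    case 0
    then show ?case using t(2) that(1) by simp
  next
    case (Suc q)
    have "Suc (Suc q) \<le> Suc q * 2" by simp
    also have "\<dots> \<le> Suc q * (\<Sum>l < ?n. (M ^\<^sub>m t) $$ (l, j))"
      using col_sum[OF Suc.prems] by (rule mult_le_mono2)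
    also have "\<dots> = (\<Sum>l < ?n. Suc q * (M ^\<^sub>m t) $$ (l, j))" by (rule sum_distrib_left)
    also have "\<dots> \<le> (\<Sum>l < ?n. (M ^\<^sub>m (Suc q * t)) $$ (i, l) * (M ^\<^sub>m t) $$ (l, j))"
      using Suc.IH by (intro sum_mono mult_le_mono1) (simp add: Suc_le_eq)
    also have "\<dots> = (M ^\<^sub>m (Suc q * t + t)) $$ (i, j)"
      unfolding pow_mat_add[OF M]
      using mult_mat_index_sum[OF pow_carrier_mat[OF M] pow_carrier_mat[OF M] that(1) Suc.prems] by simp
    also have "Suc q * t + t = Suc (Suc q) * t" by simp
    finally show ?case by simp
  qed
  moreover have "0 < Suc b * t" using t(1) by simp
  ultimately show ?thesis by blast
qed


section \<open>Splitting vertices\<close>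

text \<open>The diagram of \<open>A, B, A, B, \<dots>\<close> has \<open>A B\<close> on its even levels and \<open>B A\<close> on its odd ones.  The
  condition on the columns of \<open>A\<close> says that the odd levels start with labels 1.\<close>

lemma telescope_moves_swap_factors:
  assumes A: "A \<in> carrier_mat n m" and B: "B \<in> carrier_mat m n"
    and alternating: "bratteli_matrices (\<lambda>k. if even k then A else B)"
    and col_sum: "\<And>j. j < m \<Longrightarrow> (\<Sum>i < n. A $$ (i, j)) = 1"
  shows "bratteli_matrices (\<lambda>_. B * A)"
    and "telescope_move\<^sup>*\<^sup>* (seq_diagram (\<lambda>_. A * B)) (seq_diagram (\<lambda>_. B * A))"
proof -
  let ?T = "\<lambda>k :: nat. if even k then A else B"
  have two: "transit T k 2 = T k * T (Suc k)" for T k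
    by (simp add: numeral_2_eq_2)
  have evens: "strict_mono (\<lambda>q :: nat. 2 * q)" and odds: "strict_mono (\<lambda>q :: nat. 2 * q + 1)"
    by (simp_all add: strict_mono_def)
  have gaps: "2 * Suc q - 2 * q = 2" "2 * Suc q + 1 - (2 * q + 1) = 2" for q by simp_all
  have AB: "A * B = transit ?T (2 * q) (2 * Suc q - 2 * q)" for q
    unfolding gaps two by simp
  have BA: "B * A = transit ?T (2 * q + 1) (2 * Suc q + 1 - (2 * q + 1))" for q
    unfolding gaps two by simp
  have unit: "seq_label ?T (2 * 0 + 1) j = 1" if "j < dim_row (?T (2 * 0 + 1))" for j
    using that col_sum[of j] A B by simp
  show "bratteli_matrices (\<lambda>_. B * A)" by (rule bratteli_matrices_transit[OF alternating BA odds])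
  have "telescope_move (seq_diagram (\<lambda>_. A * B)) (seq_diagram ?T)"
    by (rule telescope_move_seq_diagram(2)[OF alternating evens AB]) simp
  moreover have "telescope_move (seq_diagram ?T) (seq_diagram (\<lambda>_. B * A))"
    by (rule telescope_move_seq_diagram(1)[OF alternating odds BA unit])
  ultimately show "telescope_move\<^sup>*\<^sup>* (seq_diagram (\<lambda>_. A * B)) (seq_diagram (\<lambda>_. B * A))"
    by (meson converse_rtranclp_into_rtranclp r_into_rtranclp)
qed

text \<open>The row with index 0 is the one that is split: \<open>m - n\<close> of its summands are rows of ones, and one
  summand is the remainder, which is positive as the entries exceed \<open>m - n\<close>.\<close>

lemma split_first_row:
  fixes N :: "nat mat"
  assumes N: "N \<in> carrier_mat n n" and "0 < n" "n \<le> m"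
    and big: "\<And>i j. i < n \<Longrightarrow> j < n \<Longrightarrow> m - n < N $$ (i, j)"
  obtains A B where "A \<in> carrier_mat n m" "B \<in> carrier_mat m n" "N = A * B"
    "\<forall>j < m. (\<Sum>i < n. A $$ (i, j)) = 1"
    "\<forall>i < n. \<exists>j < m. 0 < A $$ (i, j)"
    "\<forall>j < m. \<forall>i < n. 0 < B $$ (j, i)"
proof -
  (* g sends a new vertex to the vertex of which it is a copy. *)
  define g where "g j = (if j < n then j else 0)" for j
  define A where "A = mat n m (\<lambda>(i, j). of_bool (g j = i) :: nat)"
  define B where "B = mat m n (\<lambda>(j, i).
    if n \<le> j then 1 else if j = 0 then N $$ (0, i) - (m - n) else N $$ (j, i))"
  have A: "A \<in> carrier_mat n m" and B: "B \<in> carrier_mat m n" by (simp_all add: A_def B_def)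
  have g: "g j < n" for j using assms(2) by (simp add: g_def)
  have sum_split: "(\<Sum>j < m. h j) = (\<Sum>j < n. h j) + (\<Sum>j \<in> {n..<m}. h j)" for h :: "nat \<Rightarrow> nat"
    using assms(3) by (metis atLeast0LessThan le0 sum.atLeastLessThan_concat)
  have "N = A * B"
  proof (rule eq_matI)
    fix i i' assume "i < dim_row (A * B)" "i' < dim_col (A * B)"
    then have i: "i < n" "i' < n" using A B by auto
    have "(A * B) $$ (i, i') = (\<Sum>j < m. of_bool (g j = i) * B $$ (j, i'))"
      unfolding mult_mat_index_sum[OF A B i] using i by (intro sum.cong) (auto simp: A_def)
    also have "\<dots> = (\<Sum>j < n. of_bool (j = i) * B $$ (j, i')) + (\<Sum>j \<in> {n..<m}. of_bool (i = 0))"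
      unfolding sum_split using i by (intro arg_cong2[of _ _ _ _ "(+)"] sum.cong) (auto simp: g_def B_def)
    also have "(\<Sum>j < n. of_bool (j = i) * B $$ (j, i')) = (\<Sum>j < n. if j = i then B $$ (j, i') else 0)"
      by (intro sum.cong) auto
    also have "\<dots> = B $$ (i, i')" using i by simp
    also have "B $$ (i, i') + (\<Sum>j \<in> {n..<m}. of_bool (i = 0)) = N $$ (i, i')"
      using i assms(3) le_add_diff_inverse2[OF less_imp_le[OF big[OF i]]]
      by (cases "i = 0") (simp_all add: B_def)
    finally show "N $$ (i, i') = (A * B) $$ (i, i')" ..
  qed (use N A B in auto)
  moreover have "\<forall>j < m. (\<Sum>i < n. A $$ (i, j)) = 1"
  proof (intro allI impI)
    fix j assume "j < m"
    then have "(\<Sum>i < n. A $$ (i, j)) = (\<Sum>i < n. if i = g j then 1 else 0)"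
      by (intro sum.cong) (auto simp: A_def)
    then show "(\<Sum>i < n. A $$ (i, j)) = 1" using g by simp
  qed
  moreover have "\<forall>i < n. \<exists>j < m. 0 < A $$ (i, j)"
  proof (intro allI impI)
    fix i assume "i < n"
    then show "\<exists>j < m. 0 < A $$ (i, j)"
      using assms(3) by (intro exI[of _ i]) (simp add: A_def g_def)
  qed
  moreover have "\<forall>j < m. \<forall>i < n. 0 < B $$ (j, i)"
  proof (intro allI impI)
    fix j i assume "j < m" "i < n"
    then show "0 < B $$ (j, i)" using big[of j i] big[of 0 i] assms(2) by (auto simp: B_def)
  qed
  ultimately show ?thesis by (rule that[OF A B])
qed

text \<open>A word with prescribed numbers of occurrences is obtained by writing each letter as often as
  needed.\<close>

lemma is_substitution_mat_if_square:
  assumes "D \<in> carrier_mat m m" "0 < m"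
  shows "is_substitution_mat m D"
proof -
  let ?\<sigma> = "\<lambda>i. concat (map (\<lambda>j. replicate (D $$ (i, j)) j) [0..<m])"
  have count: "count_list (replicate q x) y = (if x = y then q else 0)" for q and x y :: nat
    by (induction q) auto
  have count_concat: "count_list (concat (map (\<lambda>j. replicate (f j) j) [0..<l])) j = (if j < l then f j else 0)"
    for f :: "nat \<Rightarrow> nat" and l j
    by (induction l) (auto simp: count)
  have "D = substitution_mat [0..<m] ?\<sigma>"
    using assms(1) by (intro eq_matI) (auto simp: substitution_mat_def count_concat)
  moreover have "symbolic_substitution [0..<m] ?\<sigma>"
    using assms(2) by (auto simp: symbolic_substitution_def)
  ultimately show ?thesis
    unfolding is_substitution_mat_def
    by (intro exI[of _ "[0..<m]"] exI[of _ ?\<sigma>]) simp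
qed

theorem proposition4p6:
  fixes n m :: nat and M :: "nat mat"
  assumes "is_substitution_mat n M"
    and "primitive_mat M"
    and "M \<noteq> 1\<^sub>m 1"
    and "n < m"
  shows "\<exists>D. is_substitution_mat m D \<and> primitive_mat D \<and>
           telescope_equivalent (mat_diagram M) (mat_diagram D)"
proof -
  have n: "dim_row M = n" "0 < n"
    using assms(1) by (auto simp: is_substitution_mat_def substitution_mat_def symbolic_substitution_def)
  have M: "M \<in> carrier_mat n n" using assms(2) n by (auto simp: primitive_mat_def)
  have BM: "bratteli_matrices (\<lambda>_. M)" using bratteli_matrices_primitive assms(2) n by simp
  obtain k where k: "0 < k" "\<And>i j. i < n \<Longrightarrow> j < n \<Longrightarrow> m - n < (M ^\<^sub>m k) $$ (i, j)"
    using primitive_power_entries_unbounded[OF assms(2,3)] n by metis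
  from split_first_row[OF pow_carrier_mat[OF M] n(2) less_imp_le[OF assms(4)] k(2)]
  obtain A B where A: "A \<in> carrier_mat n m" and B: "B \<in> carrier_mat m n" and AB: "M ^\<^sub>m k = A * B"
    and col: "\<forall>j < m. (\<Sum>i < n. A $$ (i, j)) = 1"
    and row: "\<forall>i < n. \<exists>j < m. 0 < A $$ (i, j)"
    and Bpos: "\<forall>j < m. \<forall>i < n. 0 < B $$ (j, i)"
    .
  have Acol: "\<exists>i < n. 0 < A $$ (i, j)" if "j < m" for j
  proof (rule ccontr)
    assume "\<not> (\<exists>i < n. 0 < A $$ (i, j))"
    then have "(\<Sum>i < n. A $$ (i, j)) = 0" by (intro sum.neutral) auto
    then show False using col that by simp
  qed
  have alternating: "bratteli_matrices (\<lambda>k. if even k then A else B)"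
    unfolding bratteli_matrices_def using A B row Acol Bpos n(2) assms(4) by fastforce
  let ?D = "B * A"
  have D: "?D \<in> carrier_mat m m" using A B by simp
  have Dpos: "0 < ?D $$ (i, j)" if ij: "i < m" "j < m" for i j
  proof -
    obtain l where "l < n" "0 < A $$ (l, j)" using Acol[OF ij(2)] by blast
    then show ?thesis
      unfolding mult_mat_index_sum[OF B A ij] using Bpos ij(1) by (intro sum_pos2[of _ l]) auto
  qed
  have "?D ^\<^sub>m 1 = ?D" using D by simp
  then have "primitive_mat ?D"
    unfolding primitive_mat_def using A B Dpos by (intro conjI exI[of _ 1]) simp_all
  moreover have "telescope_equivalent (mat_diagram M) (mat_diagram ?D)"
  proof (rule telescope_equivalent_mat_diagram[OF BM])
    show "bratteli_matrices (\<lambda>_. ?D)"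
      by (rule telescope_moves_swap_factors(1)[OF A B alternating col[rule_format]])
    show "telescope_move\<^sup>*\<^sup>* (seq_diagram (\<lambda>_. M)) (seq_diagram (\<lambda>_. ?D))"
      using telescope_move_power[OF BM k(1)] telescope_moves_swap_factors(2)[OF A B alternating col[rule_format]]
      unfolding AB by (rule converse_rtranclp_into_rtranclp)
  qed
  ultimately show ?thesis using is_substitution_mat_if_square[OF D] assms(4) by auto
qed

end
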